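(* For every integer $n \ge 4$, the polynomial $\Delta_n$ is an irreducible element of the polynomial ring $\mathbb{C}[d_{01}, d_{02}, \dots, d_{(n-1)\,n}]$.
   Context: For an integer $n\ge 1$ let $\{d_{ij} : 0\le i<j\le n\}$ be a set of $n(n+1)/2$ independent variables. Define $$\Delta_n:=\det\begin{bmatrix} 0 & d_{01}^2 & d_{02}^2 & \cdots & d_{0n}^2\\ d_{01}^2 & 0 & d_{12}^2 & \cdots & d_{1n}^2\\ d_{02}^2 & d_{12}^2 & 0 & \cdots & d_{2n}^2\\ \vdots & & & \ddots & \\ d_{0n}^2 & d_{1n}^2 & d_{2n}^2 & \cdots & 0\end{bmatrix}\in\mathbb{Z}[d_{01},d_{02},\dots,d_{(n-1)\,n}],$$ the determinant of the symmetric $(n+1)\times(n+1)$ matrix with rows and columns indexed by $0,\dots,n$, with zero diagonal and with $(i,j)$ and $(j,i)$ entries equal to $d_{ij}^2$ for $i<j$. *)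

theory Defs
  imports
    "HOL-Library.Poly_Mapping"
    "HOL-Algebra.Ring_Divisibility"
    "Jordan_Normal_Form.Determinant"
begin

text \<open>
  Multivariate polynomials are finitely supported maps from monomials (finitely supported
  exponent functions) to coefficients, with the convolution product of
  \<^theory>\<open>HOL-Library.Poly_Mapping\<close>.
\<close>

type_synonym ('v, 'a) mpoly = "('v \<Rightarrow>\<^sub>0 nat) \<Rightarrow>\<^sub>0 'a"

definition mvar :: "'v \<Rightarrow> ('v, 'a::comm_ring_1) mpoly" where
  "mvar v = Poly_Mapping.single (Poly_Mapping.single v 1) 1"

definition mpoly_ring :: "'v set \<Rightarrow> ('v, 'a::comm_ring_1) mpoly ring" where
  "mpoly_ring V =
     \<lparr>carrier = {p. \<forall>m \<in> Poly_Mapping.keys p. Poly_Mapping.keys m \<subseteq> V},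
      mult = (*), one = 1, zero = 0, add = (+)\<rparr>"

text \<open>The pair \<open>(i, j)\<close> with \<open>i < j\<close> indexes the variable $d_{ij}$.\<close>

definition dist_vars :: "nat \<Rightarrow> (nat \<times> nat) set" where
  "dist_vars n = {(i, j). i < j \<and> j \<le> n}"

definition Delta_mat :: "nat \<Rightarrow> (nat \<times> nat, 'a::comm_ring_1) mpoly mat" where
  "Delta_mat n = mat (n + 1) (n + 1)
     (\<lambda>(i, j). if i = j then 0 else (mvar (min i j, max i j))\<^sup>2)"

text \<open>
  The coefficient ring is left generic; the entries of the matrix have coefficients 0 and 1,
  so each instance is the image of the one over the integers.
\<close>

definition Delta :: "nat \<Rightarrow> (nat \<times> nat, 'a::comm_ring_1) mpoly" where
  "Delta n = det (Delta_mat n)"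

lemma mpoly_ring_simps [simp]:
  "mult (mpoly_ring V) = (*)" "one (mpoly_ring V) = 1"
  "zero (mpoly_ring V) = 0" "add (mpoly_ring V) = (+)"
  by (simp_all add: mpoly_ring_def)

lemma mpoly_ring_carrier_iff:
  "p \<in> carrier (mpoly_ring V) \<longleftrightarrow> (\<forall>m \<in> Poly_Mapping.keys p. Poly_Mapping.keys m \<subseteq> V)"
  by (simp add: mpoly_ring_def)

lemma mpoly_ring_closed:
  shows "0 \<in> carrier (mpoly_ring V)" "1 \<in> carrier (mpoly_ring V)"
    and "p \<in> carrier (mpoly_ring V) \<Longrightarrow> - p \<in> carrier (mpoly_ring V)"
    and "p \<in> carrier (mpoly_ring V) \<Longrightarrow> q \<in> carrier (mpoly_ring V) \<Longrightarrow>
           p + q \<in> carrier (mpoly_ring V)"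
    and "p \<in> carrier (mpoly_ring V) \<Longrightarrow> q \<in> carrier (mpoly_ring V) \<Longrightarrow>
           p * q \<in> carrier (mpoly_ring V)"
proof -
  show "0 \<in> carrier (mpoly_ring V)" "1 \<in> carrier (mpoly_ring V)"
    by (simp_all add: mpoly_ring_carrier_iff)
  show "- p \<in> carrier (mpoly_ring V)" if "p \<in> carrier (mpoly_ring V)"
    using that by (simp add: mpoly_ring_carrier_iff in_keys_iff)
  show "p + q \<in> carrier (mpoly_ring V)"
    if "p \<in> carrier (mpoly_ring V)" "q \<in> carrier (mpoly_ring V)"
    using that Poly_Mapping.keys_add[of p q] by (auto simp: mpoly_ring_carrier_iff dest!: subsetD)
  show "p * q \<in> carrier (mpoly_ring V)"
    if pq: "p \<in> carrier (mpoly_ring V)" "q \<in> carrier (mpoly_ring V)"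
    unfolding mpoly_ring_carrier_iff
  proof
    fix m assume "m \<in> Poly_Mapping.keys (p * q)"
    then obtain a b where "m = a + b" "a \<in> Poly_Mapping.keys p" "b \<in> Poly_Mapping.keys q"
      using Poly_Mapping.keys_mult[of p q] by blast
    with pq show "Poly_Mapping.keys m \<subseteq> V"
      using Poly_Mapping.keys_add[of a b] by (auto simp: mpoly_ring_carrier_iff dest!: subsetD)
  qed
qed

lemma cring_mpoly_ring: "cring (mpoly_ring V :: ('v, 'a::comm_ring_1) mpoly ring)"
proof (rule cringI)
  show "abelian_group (mpoly_ring V :: ('v, 'a) mpoly ring)"
  proof (rule abelian_groupI)
    fix p :: "('v, 'a) mpoly" assume "p \<in> carrier (mpoly_ring V)"
    then show "\<exists>q\<in>carrier (mpoly_ring V). q \<oplus>\<^bsub>mpoly_ring V\<^esub> p = \<zero>\<^bsub>mpoly_ring V\<^esub>"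
      by (intro bexI[of _ "- p"]) (simp_all add: mpoly_ring_closed)
  qed (simp_all add: mpoly_ring_closed add_ac)
  show "comm_monoid (mpoly_ring V :: ('v, 'a) mpoly ring)"
    by (rule comm_monoidI) (simp_all add: mpoly_ring_closed mult_ac)
qed (simp add: distrib_right)

lemma mvar_carrier: "v \<in> V \<Longrightarrow> mvar v \<in> carrier (mpoly_ring V)"
  by (simp add: mpoly_ring_carrier_iff mvar_def)

lemma Delta_carrier: "Delta n \<in> carrier (mpoly_ring (dist_vars n))"
proof -
  let ?C = "carrier (mpoly_ring (dist_vars n) :: (nat \<times> nat, 'a) mpoly ring)"
  have entry: "Delta_mat n $$ (i, j) \<in> ?C" if "i < n + 1" "j < n + 1" for i j
    using that
    by (auto simp: Delta_mat_def power2_eq_square dist_vars_def min_def max_def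
        intro!: mpoly_ring_closed mvar_carrier)
  have sum: "(\<Sum>x\<in>A. f x) \<in> ?C" if "\<And>x. x \<in> A \<Longrightarrow> f x \<in> ?C" for A :: "(nat \<Rightarrow> nat) set" and f
    using that by (induction A rule: infinite_finite_induct) (auto intro: mpoly_ring_closed)
  have prod: "(\<Prod>x\<in>A. f x) \<in> ?C" if "\<And>x. x \<in> A \<Longrightarrow> f x \<in> ?C" for A :: "nat set" and f
    using that by (induction A rule: infinite_finite_induct) (auto intro: mpoly_ring_closed)
  have sign: "signof s \<in> ?C" for s :: "nat \<Rightarrow> nat"
    by (auto simp: sign_def intro!: mpoly_ring_closed)
  have dim: "dim_row (Delta_mat n :: (nat \<times> nat, 'a) mpoly mat) = n + 1"
    "dim_col (Delta_mat n :: (nat \<times> nat, 'a) mpoly mat) = n + 1"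
    by (simp_all add: Delta_mat_def)
  show ?thesis
    unfolding Delta_def Determinant.det_def dim
    by (auto intro!: sum prod sign mpoly_ring_closed(5) entry simp del: Suc_eq_plus1
        dest: permutes_in_image)
qed

end

theory Submission
  imports Defs "HOL-Library.Product_Lexorder" "HOL-Computational_Algebra.Fundamental_Theorem_Algebra"
begin

text \<open>
  Think of \<open>d\<close> as edge weights on the complete graph with vertices \<open>0, \<dots>, n\<close>. Scaling all
  edges at one vertex by \<open>t\<close> multiplies \<open>Delta n\<close> by \<open>t ^ 4\<close>, so \<open>Delta n\<close> is homogeneous in the
  edges at each vertex, and hence so is every factor. A factor has the same degree at all
  vertices: on a graph whose only edge at \<open>i\<close> or \<open>j\<close> is the edge between them, scaling at \<open>i\<close>
  and scaling at \<open>j\<close> are the same operation, and the complete graph on the other vertices makes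
  the determinant nonzero (\<open>factor_vertex_degrees\<close>). A factor of degree \<open>0\<close> is a
  constant, so in a proper factorisation \<open>Delta n = p * q\<close> both factors have positive degree at
  vertex \<open>0\<close>, and both vanish as soon as all edges at \<open>0\<close> have weight \<open>0\<close>.

  The contradiction comes from a zero of \<open>Delta n\<close> at which both factors vanish although
  \<open>Delta n\<close> vanishes there only to first order. Let all edges among \<open>1, \<dots>, n\<close> have weight \<open>1\<close>
  except the edge \<open>(1, 2)\<close> of weight \<open>s\<close>, where \<open>(n - 3) * s\<^sup>2 = 2 * (n - 2)\<close>. The matrix \<open>M\<close>
  of these \<open>n\<close> vertices then has corank one, with kernel vector
  \<open>k = (n - 3, n - 3, -2, \<dots>, -2)\<close>, so its adjugate is a multiple of \<open>k k\<^sup>T\<close>. If vertex \<open>0\<close> is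
  joined to \<open>j\<close> by an edge of weight \<open>y j\<close>, the determinant is therefore a nonzero multiple of the
  square of \<open>Q y = (\<Sum>j. k j * (y j)\<^sup>2)\<close>. For \<open>y = (z, \<i> * z, x, 0, \<dots>)\<close> one gets
  \<open>Q y = -2 * x\<^sup>2\<close>, free of \<open>z\<close>. For fixed \<open>x \<noteq> 0\<close> each factor is thus a polynomial in \<open>z\<close>
  without zeros, that is, a constant. By continuity a factor takes the same value at
  \<open>(x, z) = (0, 1)\<close> as at \<open>(0, 0)\<close>, where vertex \<open>0\<close> is isolated and the value is \<open>0\<close>
  (\<open>factor_vanishes_on_config\<close>).

  So along the line on which only the weight \<open>t\<close> of the edge \<open>(1, 2)\<close> varies, with \<open>x = 0\<close> and
  \<open>z = 1\<close>, the determinant has a double zero at \<open>t = s\<close>. But row and column operations show that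
  it has the form \<open>A + B * t\<^sup>2\<close> (\<open>det_config_affine\<close>), and it is not identically zero because it
  does not vanish at \<open>t = 0\<close> (\<open>det_config_0_nonzero\<close>); such a polynomial has no double zero at
  \<open>s \<noteq> 0\<close>.

  The argument needs \<open>n - 3 > 0\<close>: for \<open>n = 3\<close> there is no such \<open>s\<close>, and \<open>Delta 3\<close> is in fact a
  product of four quadratic polynomials.
\<close>

section \<open>Substitution into multivariate polynomials\<close>

text \<open>
  The coefficients are moved by \<open>c\<close> and the variables by \<open>f\<close>, because three kinds of target ring
  occur: the scalars (evaluation at a point), univariate polynomials over the scalars
  (restriction to a curve), and univariate polynomials over the multivariate ones (gradings).
\<close>

definition insertion :: "('a \<Rightarrow> 'b) \<Rightarrow> ('v \<Rightarrow> 'b) \<Rightarrow> ('v, 'a::comm_ring_1) mpoly \<Rightarrow> 'b::comm_ring_1" where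
  "insertion c f p =
     (\<Sum>m\<in>Poly_Mapping.keys p. c (Poly_Mapping.lookup p m) * (\<Prod>v\<in>Poly_Mapping.keys m. f v ^ Poly_Mapping.lookup m v))"

lemma monomial_value_add:
  fixes f :: "'v \<Rightarrow> 'b::comm_ring_1"
  shows "(\<Prod>v\<in>Poly_Mapping.keys (a + b). f v ^ Poly_Mapping.lookup (a + b) v) =
    (\<Prod>v\<in>Poly_Mapping.keys a. f v ^ Poly_Mapping.lookup a v) * (\<Prod>v\<in>Poly_Mapping.keys b. f v ^ Poly_Mapping.lookup b v)"
proof -
  let ?S = "Poly_Mapping.keys a \<union> Poly_Mapping.keys b"
  have *: "(\<Prod>v\<in>Poly_Mapping.keys m. f v ^ Poly_Mapping.lookup m v) = (\<Prod>v\<in>?S. f v ^ Poly_Mapping.lookup m v)"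
    if "Poly_Mapping.keys m \<subseteq> ?S" for m
    by (rule prod.mono_neutral_left) (use that in \<open>auto simp: in_keys_iff\<close>)
  show ?thesis
    by (subst (1 2 3) *)
      (use Poly_Mapping.keys_add[of a b] in \<open>simp_all add: lookup_add power_add prod.distrib\<close>)
qed

context comm_ring_hom
begin

lemma insertion_superset:
  assumes "finite S" "Poly_Mapping.keys p \<subseteq> S"
  shows "insertion hom f p =
    (\<Sum>m\<in>S. hom (Poly_Mapping.lookup p m) * (\<Prod>v\<in>Poly_Mapping.keys m. f v ^ Poly_Mapping.lookup m v))"
  unfolding insertion_def
  by (rule sum.mono_neutral_left) (use assms in \<open>auto simp: in_keys_iff\<close>)

lemma insertion_add: "insertion hom f (p + q) = insertion hom f p + insertion hom f q"
proof -
  let ?S = "Poly_Mapping.keys p \<union> Poly_Mapping.keys q"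
  show ?thesis
    using Poly_Mapping.keys_add[of p q]
    by (simp add: insertion_superset[of ?S] lookup_add hom_add distrib_right sum.distrib)
qed

lemma insertion_zero: "insertion hom f 0 = 0"
  by (simp add: insertion_def)

lemma insertion_sum: "insertion hom f (\<Sum>x\<in>A. g x) = (\<Sum>x\<in>A. insertion hom f (g x))"
  by (induction A rule: infinite_finite_induct) (simp_all add: insertion_add insertion_zero)

lemma insertion_single:
  "insertion hom f (Poly_Mapping.single m a) =
     hom a * (\<Prod>v\<in>Poly_Mapping.keys m. f v ^ Poly_Mapping.lookup m v)"
  by (simp add: insertion_superset[of "{m}"])

lemma insertion_mult: "insertion hom f (p * q) = insertion hom f p * insertion hom f q"
proof -
  have p: "p = (\<Sum>m\<in>Poly_Mapping.keys p. Poly_Mapping.single m (Poly_Mapping.lookup p m))"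
    and q: "q = (\<Sum>m\<in>Poly_Mapping.keys q. Poly_Mapping.single m (Poly_Mapping.lookup q m))"
    by (auto intro!: poly_mapping_eqI simp: lookup_sum lookup_single when_def in_keys_iff)
  have *: "insertion hom f (Poly_Mapping.single a x * Poly_Mapping.single b y) =
    insertion hom f (Poly_Mapping.single a x) * insertion hom f (Poly_Mapping.single b y)" for a b x y
    by (simp add: mult_single insertion_single monomial_value_add hom_mult mult_ac)
  have "insertion hom f ((\<Sum>m\<in>Poly_Mapping.keys p. Poly_Mapping.single m (Poly_Mapping.lookup p m)) *
        (\<Sum>m\<in>Poly_Mapping.keys q. Poly_Mapping.single m (Poly_Mapping.lookup q m))) =
      insertion hom f (\<Sum>m\<in>Poly_Mapping.keys p. Poly_Mapping.single m (Poly_Mapping.lookup p m)) *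
      insertion hom f (\<Sum>m\<in>Poly_Mapping.keys q. Poly_Mapping.single m (Poly_Mapping.lookup q m))"
    by (simp only: sum_product insertion_sum *)
  then show ?thesis
    unfolding p[symmetric] q[symmetric] .
qed

lemma insertion_one: "insertion hom f 1 = 1"
  using insertion_single[of f 0 1] by simp

lemma insertion_mvar: "insertion hom f (mvar v) = f v"
  by (simp add: mvar_def insertion_single)

lemma comm_ring_hom_insertion: "comm_ring_hom (insertion hom f)"
  by unfold_locales (simp_all add: insertion_add insertion_zero insertion_mult insertion_one)

end

lemma comm_ring_hom_id: "comm_ring_hom (\<lambda>x :: 'a::comm_ring_1. x)"
  by unfold_locales simp_all

lemma comm_ring_hom_poly_const: "comm_ring_hom (\<lambda>x :: 'a::comm_ring_1. [:x:])"
  by unfold_locales (simp_all add: one_pCons)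

lemma comm_ring_hom_mpoly_const:
  "comm_ring_hom (\<lambda>x :: 'a::comm_ring_1. [:Poly_Mapping.single (0 :: 'v \<Rightarrow>\<^sub>0 nat) x:])"
  by unfold_locales (simp_all add: single_add one_pCons mult_single mult.commute)

abbreviation value_at :: "('v \<Rightarrow> 'a::comm_ring_1) \<Rightarrow> ('v, 'a) mpoly \<Rightarrow> 'a" where
  "value_at \<equiv> insertion (\<lambda>x. x)"

abbreviation along :: "('v \<Rightarrow> 'a::comm_ring_1 poly) \<Rightarrow> ('v, 'a) mpoly \<Rightarrow> 'a poly" where
  "along \<equiv> insertion (\<lambda>x. [:x:])"

interpretation value_at: comm_ring_hom "value_at f" for f :: "'v \<Rightarrow> 'a::comm_ring_1"
  by (rule comm_ring_hom.comm_ring_hom_insertion[OF comm_ring_hom_id])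

lemma poly_along: "poly (along f p) t = value_at (\<lambda>v. poly (f v) t) p"
  by (simp add: insertion_def poly_sum poly_prod)

section \<open>Factors of homogeneous polynomials\<close>

text \<open>
  Substituting \<open>v * T ^ w v\<close> for each variable \<open>v\<close> collects the part of weight \<open>k\<close> of a polynomial
  as its coefficient of \<open>T ^ k\<close>, and does so by a ring homomorphism.
\<close>

definition grading :: "('v \<Rightarrow> nat) \<Rightarrow> ('v, 'a::comm_ring_1) mpoly \<Rightarrow> ('v, 'a) mpoly poly" where
  "grading w = insertion (\<lambda>x. [:Poly_Mapping.single 0 x:]) (\<lambda>v. monom (mvar v) (w v))"

definition weight :: "('v \<Rightarrow> nat) \<Rightarrow> ('v \<Rightarrow>\<^sub>0 nat) \<Rightarrow> nat" where
  "weight w m = (\<Sum>v\<in>Poly_Mapping.keys m. w v * Poly_Mapping.lookup m v)"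

interpretation grading: comm_ring_hom "grading w :: ('v, 'a::comm_ring_1) mpoly \<Rightarrow> _" for w
  unfolding grading_def by (rule comm_ring_hom.comm_ring_hom_insertion[OF comm_ring_hom_mpoly_const])

lemma grading_mvar: "grading w (mvar v) = monom (mvar v) (w v)"
  unfolding grading_def
  by (rule comm_ring_hom.insertion_mvar[OF comm_ring_hom_mpoly_const])

lemma mvar_power: "mvar v ^ k = Poly_Mapping.single (Poly_Mapping.single v k) 1"
  by (induction k) (simp_all add: mvar_def mult_single single_add[symmetric])

lemma prod_mvar_powers:
  "(\<Prod>v\<in>Poly_Mapping.keys m. mvar v ^ Poly_Mapping.lookup m v) = (Poly_Mapping.single m 1 :: ('v, 'a::comm_ring_1) mpoly)"
proof -
  have "(\<Prod>v\<in>A. mvar v ^ Poly_Mapping.lookup m v) =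
      (Poly_Mapping.single (\<Sum>v\<in>A. Poly_Mapping.single v (Poly_Mapping.lookup m v)) 1 :: ('v, 'a) mpoly)" for A
    by (induction A rule: infinite_finite_induct) (simp_all add: mvar_power mult_single)
  also have "(\<Sum>v\<in>Poly_Mapping.keys m. Poly_Mapping.single v (Poly_Mapping.lookup m v)) = m"
    by (auto intro!: poly_mapping_eqI simp: lookup_sum lookup_single when_def in_keys_iff)
  finally show ?thesis .
qed

lemma prod_monom:
  fixes c :: "'b \<Rightarrow> 'a::comm_ring_1"
  shows "(\<Prod>x\<in>A. monom (c x) (k x)) = monom (\<Prod>x\<in>A. c x) (\<Sum>x\<in>A. k x)"
  by (induction A rule: infinite_finite_induct) (simp_all add: mult_monom)

lemma grading_altdef:
  "grading w p =
     (\<Sum>m\<in>Poly_Mapping.keys p. monom (Poly_Mapping.single m (Poly_Mapping.lookup p m)) (weight w m))"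
  unfolding grading_def insertion_def weight_def
  by (intro sum.cong refl)
    (simp add: monom_power prod_monom prod_mvar_powers smult_monom mult_single mult.commute)

lemma lookup_coeff_grading:
  "Poly_Mapping.lookup (coeff (grading w p) k) m = (if weight w m = k then Poly_Mapping.lookup p m else 0)"
proof -
  have "Poly_Mapping.lookup (coeff (grading w p) k) m =
      (\<Sum>m'\<in>Poly_Mapping.keys p. if m' = m then (if weight w m = k then Poly_Mapping.lookup p m else 0) else 0)"
    unfolding grading_altdef coeff_sum lookup_sum
    by (intro sum.cong refl) (auto simp: lookup_single when_def)
  then show ?thesis
    by (simp add: in_keys_iff)
qed

text \<open>
  The degree and the order of vanishing at \<open>0\<close> are both additive, and the latter is at most the
  former. Both sums equal \<open>n\<close>, so degree and order agree for each factor.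
\<close>

lemma factor_of_monom:
  fixes p q :: "'a::idom poly"
  assumes eq: "p * q = monom c n" and c: "c \<noteq> 0"
  shows "\<exists>a k. p = monom a k"
proof -
  have nz: "p * q \<noteq> 0" "p \<noteq> 0" "q \<noteq> 0" using eq c by auto
  have deg: "degree p + degree q = n"
    using degree_mult_eq[of p q] nz eq c by (simp add: degree_monom_eq)
  have ord: "order 0 p + order 0 q = n"
    using order_mult[of p q 0] nz eq c by (simp add: order_0_monom)
  have "order 0 p = degree p"
    using deg ord order_degree[of p 0] order_degree[of q 0] nz by linarith
  moreover obtain r where r: "p = [:- 0, 1:] ^ order 0 p * r"
    using order_1[of 0 p] by (auto simp: dvd_def)
  ultimately have "degree p = degree p + degree r"
    using nz(2) by (metis degree_linear_power degree_mult_eq mult_eq_0_iff)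
  then obtain b where b: "r = [:b:]"
    by (metis add_cancel_left_right degree_eq_zeroE)
  have "p = monom b (order 0 p)"
    by (subst r) (simp add: b monom_altdef)
  then show ?thesis by blast
qed

lemma factor_of_homogeneous:
  fixes p q :: "('v::linorder, 'a::idom) mpoly"
  assumes "grading w (p * q) = monom (p * q) n" and "p * q \<noteq> 0"
  obtains k where "\<And>m. m \<in> Poly_Mapping.keys p \<Longrightarrow> weight w m = k"
proof -
  have "grading w p * grading w q = monom (p * q) n"
    using assms(1) by (simp add: grading.hom_mult)
  then obtain a k where ak: "grading w p = monom a k"
    using factor_of_monom assms(2) by blast
  have "weight w m = k" if "m \<in> Poly_Mapping.keys p" for m
  proof (rule ccontr)
    assume "weight w m \<noteq> k"
    then have "Poly_Mapping.lookup (coeff (grading w p) (weight w m)) m = 0" by (simp add: ak)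
    with that show False by (simp add: lookup_coeff_grading in_keys_iff)
  qed
  then show ?thesis using that by blast
qed

lemma value_at_scaled:
  assumes "\<And>m. m \<in> Poly_Mapping.keys p \<Longrightarrow> weight w m = k"
  shows "value_at (\<lambda>v. t ^ w v * d v) p = t ^ k * value_at d p"
  unfolding insertion_def sum_distrib_left
proof (intro sum.cong refl)
  fix m assume "m \<in> Poly_Mapping.keys p"
  then have "(\<Prod>v\<in>Poly_Mapping.keys m. t ^ (w v * Poly_Mapping.lookup m v)) = t ^ k"
    using assms[of m] by (simp add: power_sum[symmetric] weight_def)
  then show "Poly_Mapping.lookup p m * (\<Prod>v\<in>Poly_Mapping.keys m. (t ^ w v * d v) ^ Poly_Mapping.lookup m v) =
      t ^ k * (Poly_Mapping.lookup p m * (\<Prod>v\<in>Poly_Mapping.keys m. d v ^ Poly_Mapping.lookup m v))"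
    by (simp add: power_mult_distrib power_mult[symmetric] prod.distrib)
qed

section \<open>Specialising the determinant\<close>

definition dist_mat :: "nat \<Rightarrow> (nat \<times> nat \<Rightarrow> 'a::comm_ring_1) \<Rightarrow> 'a mat" where
  "dist_mat n d = mat (n + 1) (n + 1) (\<lambda>(i, j). if i = j then 0 else (d (min i j, max i j))\<^sup>2)"

lemma dist_mat_carrier: "dist_mat n d \<in> carrier_mat (n + 1) (n + 1)"
  by (simp add: dist_mat_def)

lemma hom_Delta:
  assumes "comm_ring_hom h"
  shows "h (Delta n) = det (dist_mat n (\<lambda>e. h (mvar e)))"
proof -
  interpret comm_ring_hom h by fact
  have "map_mat h (Delta_mat n) = dist_mat n (\<lambda>e. h (mvar e))"
    by (rule eq_matI) (auto simp: Delta_mat_def dist_mat_def hom_power)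
  then show ?thesis
    by (simp add: Delta_def flip: hom_det)
qed

lemma value_at_Delta: "value_at d (Delta n) = det (dist_mat n d)"
  using hom_Delta[OF value_at.comm_ring_hom_axioms, of d n]
  by (simp add: comm_ring_hom.insertion_mvar[OF comm_ring_hom_id])

text \<open>Every term of the Leibniz formula picks up each \<open>r i\<close> once from its row and once from its column.\<close>

lemma det_scale_rows_cols:
  assumes A: "A \<in> carrier_mat N N"
  shows "det (mat N N (\<lambda>(i, j). r i * r j * A $$ (i, j))) = (\<Prod>i<N. r i)\<^sup>2 * det A"
proof -
  have "(\<Prod>i = 0..<N. r i * r (p i) * A $$ (i, p i)) =
      (\<Prod>i<N. r i)\<^sup>2 * (\<Prod>i = 0..<N. A $$ (i, p i))" if p: "p permutes {0..<N}" for p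
    using prod.permute[OF p, of r]
    by (simp add: prod.distrib comp_def power2_eq_square atLeast0LessThan)
  moreover have "p i < N" if "p permutes {0..<N}" "i < N" for p i
    using permutes_in_image[OF that(1), of i] that(2) by simp
  ultimately show ?thesis
    using A by (simp add: Determinant.det_def sum_distrib_left mult_ac)
qed

lemma det_dist_mat_scale:
  "det (dist_mat n (\<lambda>(i, j). r i * r j * d (i, j))) = (\<Prod>i\<le>n. r i) ^ 4 * det (dist_mat n d)"
proof -
  have "dist_mat n (\<lambda>(i, j). r i * r j * d (i, j)) =
      mat (n + 1) (n + 1) (\<lambda>(i, j). (r i)\<^sup>2 * (r j)\<^sup>2 * dist_mat n d $$ (i, j))"
    by (rule eq_matI) (auto simp: dist_mat_def min_def max_def power_mult_distrib)
  then have "det (dist_mat n (\<lambda>(i, j). r i * r j * d (i, j))) =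
      (\<Prod>i<n + 1. (r i)\<^sup>2)\<^sup>2 * det (dist_mat n d)"
    using det_scale_rows_cols[OF dist_mat_carrier[of n d], of "\<lambda>i. (r i)\<^sup>2"] by simp
  also have "(\<Prod>i<n + 1. (r i)\<^sup>2)\<^sup>2 = (\<Prod>i\<le>n. r i) ^ 4"
    by (simp add: lessThan_Suc_atMost prod_power_distrib flip: power_mult)
  finally show ?thesis .
qed

text \<open>
  Nonvanishing of all determinants below is shown by solving the linear system, which avoids
  computing their values.
\<close>

lemma det_dist_mat_nonzero:
  fixes d :: "nat \<times> nat \<Rightarrow> 'a::idom"
  assumes "\<And>c j. (\<And>i. i \<le> n \<Longrightarrow>
      (\<Sum>j\<le>n. (if i = j then 0 else (d (min i j, max i j))\<^sup>2) * c j) = 0) \<Longrightarrow> j \<le> n \<Longrightarrow> c j = 0"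
  shows "det (dist_mat n d) \<noteq> 0"
proof
  assume "det (dist_mat n d) = 0"
  then obtain v where v: "v \<in> carrier_vec (n + 1)" "v \<noteq> 0\<^sub>v (n + 1)"
      "dist_mat n d *\<^sub>v v = 0\<^sub>v (n + 1)"
    using det_0_iff_vec_prod_zero[OF dist_mat_carrier] by blast
  have "v $ j = 0" if "j \<le> n" for j
  proof (rule assms[OF _ that])
    fix i assume i: "i \<le> n"
    have "(dist_mat n d *\<^sub>v v) $ i =
        (\<Sum>j<n + 1. (if i = j then 0 else (d (min i j, max i j))\<^sup>2) * v $ j)"
      using i v(1) by (simp add: dist_mat_def scalar_prod_def atLeast0LessThan)
    then show "(\<Sum>j\<le>n. (if i = j then 0 else (d (min i j, max i j))\<^sup>2) * v $ j) = 0"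
      using i v(3) by (simp add: lessThan_Suc_atMost)
  qed
  then have "v = 0\<^sub>v (n + 1)" using v(1) by (intro eq_vecI) auto
  with v(2) show False ..
qed

section \<open>The degree at a vertex\<close>

definition incidence :: "nat \<Rightarrow> nat \<times> nat \<Rightarrow> nat" where
  "incidence i e = of_bool (fst e = i) + of_bool (snd e = i)"

lemma grading_Delta:
  assumes "i \<le> n"
  shows "grading (incidence i) (Delta n :: (nat \<times> nat, 'a::comm_ring_1) mpoly) = monom (Delta n) 4"
proof -
  (* The substitution scales vertex i by the polynomial variable and fixes the other vertices. *)
  define r :: "nat \<Rightarrow> (nat \<times> nat, 'a) mpoly poly" where "r k = monom 1 (of_bool (k = i))" for k
  have "monom (mvar e) (incidence i e) = r (fst e) * r (snd e) * [:mvar e:]" for e :: "nat \<times> nat"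
    by (simp add: r_def incidence_def mult_monom flip: monom_0)
  then have "grading (incidence i) (Delta n :: (nat \<times> nat, 'a) mpoly) =
      det (dist_mat n (\<lambda>(a, b). r a * r b * [:mvar (a, b):]))"
    by (simp add: hom_Delta[OF grading.comm_ring_hom_axioms] grading_mvar case_prod_unfold)
  also have "\<dots> = (\<Prod>k\<le>n. r k) ^ 4 * det (dist_mat n (\<lambda>e. [:mvar e:]))"
    by (rule det_dist_mat_scale)
  also have "(\<Prod>k\<le>n. r k) = monom 1 1"
    using assms prod.remove[of "{..n}" i r] by (simp add: r_def)
  also have "det (dist_mat n (\<lambda>e. [:mvar e:])) = [:Delta n :: (nat \<times> nat, 'a) mpoly:]"
    by (rule hom_Delta[OF comm_ring_hom_poly_const, symmetric])
  finally show ?thesis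
    by (simp add: monom_power mult_monom flip: monom_0)
qed

text \<open>
  The disjoint union of the edge between \<open>i\<close> and \<open>j\<close> and the complete graph on the remaining
  vertices. Its value does not depend on the order within a pair, so that the symmetric
  scaling argument applies to all variables, including those with \<open>fst e \<ge> snd e\<close>.
\<close>

definition edge_plus_clique :: "nat \<Rightarrow> nat \<Rightarrow> nat \<times> nat \<Rightarrow> complex" where
  "edge_plus_clique i j e =
     (if fst e \<in> {i, j} \<or> snd e \<in> {i, j} then of_bool ({fst e, snd e} = {i, j}) else 1)"

lemma det_edge_plus_clique:
  assumes "n \<ge> 3" "i \<le> n" "j \<le> n" "i \<noteq> j"
  shows "det (dist_mat n (edge_plus_clique i j)) \<noteq> 0"
proof (rule det_dist_mat_nonzero)
  fix c :: "nat \<Rightarrow> complex" and k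
  assume row: "(\<Sum>l\<le>n. (if k = l then 0
      else (edge_plus_clique i j (min k l, max k l))\<^sup>2) * c l) = 0" if "k \<le> n" for k
  assume k: "k \<le> n"
  define T where "T = {..n} - {i, j}"
  have entry: "edge_plus_clique i j (min k l, max k l) =
      (if k \<in> {i, j} \<or> l \<in> {i, j} then of_bool ({k, l} = {i, j}) else 1)" for k l
    by (auto simp: edge_plus_clique_def min_def max_def insert_commute)
  have ends: "c j = 0" "c i = 0"
  proof -
    have "(\<Sum>l\<le>n. (if i = l then 0
      else (edge_plus_clique i j (min i l, max i l))\<^sup>2) * c l) = (\<Sum>l\<le>n. if l = j then c j else 0)"
      by (intro sum.cong refl) (use assms in \<open>auto simp: entry doubleton_eq_iff\<close>)
    then show "c j = 0" using row[OF assms(2)] assms by simp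
    have "(\<Sum>l\<le>n. (if j = l then 0
      else (edge_plus_clique i j (min j l, max j l))\<^sup>2) * c l) = (\<Sum>l\<le>n. if l = i then c i else 0)"
      by (intro sum.cong refl) (use assms in \<open>auto simp: entry doubleton_eq_iff\<close>)
    then show "c i = 0" using row[OF assms(3)] assms by simp
  qed
  define S where "S = (\<Sum>l\<in>T. c l)"
  have rest: "c k = S" if "k \<in> T" for k
  proof -
    have "(\<Sum>l\<le>n. (if k = l then 0 else (edge_plus_clique i j (min k l, max k l))\<^sup>2) * c l) =
        (\<Sum>l\<in>T - {k}. c l)"
      by (rule sum.mono_neutral_cong_right)
        (use that in \<open>auto simp: entry T_def doubleton_eq_iff\<close>)
    also have "\<dots> = S - c k"
      using that by (simp add: S_def T_def sum_diff1)
    finally show ?thesis using row[of k] that by (simp add: T_def)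
  qed
  have "S = (\<Sum>l\<in>T. S)" unfolding S_def[symmetric] by (subst S_def) (simp add: rest)
  moreover have "card T = n - 1"
    using assms by (simp add: T_def card_Diff_subset)
  ultimately have "S = of_nat (n - 1) * S" by simp
  moreover have "of_nat (n - 1) \<noteq> (of_nat 1 :: complex)"
    unfolding of_nat_eq_iff using assms(1) by linarith
  ultimately have "S = 0" by simp
  then show "c k = 0"
    using ends rest k by (cases "k \<in> T") (auto simp: T_def)
qed

section \<open>A family of configurations\<close>

text \<open>
  The weights of the edges from vertex \<open>0\<close> to \<open>1, 2, 3\<close> are \<open>z, \<i> * z, x\<close>; that from \<open>1\<close> to \<open>2\<close> is \<open>s\<close>.
  The matrix contains the squares \<open>z\<^sup>2\<close> and \<open>- z\<^sup>2\<close>, which cancel in the quadratic form belonging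
  to the kernel vector \<open>(n - 3, n - 3, -2, \<dots>, -2)\<close>. Pairs with second component \<open>0\<close> get
  weight \<open>0\<close> so that vertex \<open>0\<close> is isolated for \<open>x = z = 0\<close>.
\<close>

definition config :: "complex \<Rightarrow> complex \<Rightarrow> complex \<Rightarrow> nat \<times> nat \<Rightarrow> complex" where
  "config s x z e =
     (if fst e = 0 then
        if snd e = 1 then z else if snd e = 2 then \<i> * z else if snd e = 3 then x else 0
      else if snd e = 0 then 0
      else if e = (1, 2) then s else 1)"

text \<open>The rows of the linear system; the vertices \<open>3, \<dots>, n\<close> enter mostly through the sum \<open>S\<close>.\<close>

lemma config_rows:
  assumes n: "n \<ge> 4"
    and row: "\<And>i. i \<le> n \<Longrightarrow>
      (\<Sum>j\<le>n. (if i = j then 0 else (config s x z (min i j, max i j))\<^sup>2) * c j) = 0"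
  defines "S \<equiv> (\<Sum>j=3..n. c j)"
  shows "z\<^sup>2 * c 1 - z\<^sup>2 * c 2 + x\<^sup>2 * c 3 = 0"
    and "z\<^sup>2 * c 0 + s\<^sup>2 * c 2 + S = 0"
    and "- z\<^sup>2 * c 0 + s\<^sup>2 * c 1 + S = 0"
    and "k \<in> {3..n} \<Longrightarrow> (if k = 3 then x\<^sup>2 * c 0 else 0) + c 1 + c 2 + S - c k = 0"
proof -
  have split: "(\<Sum>j\<le>n. f j) = f 0 + f 1 + f 2 + (\<Sum>j=3..n. f j)" for f :: "nat \<Rightarrow> complex"
  proof -
    have "{..n} = insert 0 (insert 1 (insert 2 {3..n}))" using n by auto
    then show ?thesis by (simp add: add.assoc)
  qed
  have tail: "(\<Sum>j=3..n. f j) = f 3 + (\<Sum>j=4..n. f j)" for f :: "nat \<Rightarrow> complex"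
    using n by (simp add: sum.atLeast_Suc_atMost)
  have S: "(\<Sum>j=3..n. f j) = S" if "\<And>j. j \<in> {3..n} \<Longrightarrow> f j = c j" for f
    unfolding S_def by (rule sum.cong) (use that in auto)
  have i2: "(\<i> * z)\<^sup>2 = - z\<^sup>2" by (simp add: power_mult_distrib)
  have "(\<Sum>j=4..n. (if 0 = j then 0 else (config s x z (min 0 j, max 0 j))\<^sup>2) * c j) = 0"
    by (intro sum.neutral) (auto simp: config_def)
  then show "z\<^sup>2 * c 1 - z\<^sup>2 * c 2 + x\<^sup>2 * c 3 = 0"
    using row[of 0] unfolding split tail by (simp add: config_def i2)
  have "(\<Sum>j=3..n. (if 1 = j then 0 else (config s x z (min 1 j, max 1 j))\<^sup>2) * c j) = S"
    by (rule S) (auto simp: config_def min_def max_def)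
  then show "z\<^sup>2 * c 0 + s\<^sup>2 * c 2 + S = 0"
    using row[of 1] n unfolding split by (simp add: config_def)
  have "(\<Sum>j=3..n. (if 2 = j then 0 else (config s x z (min 2 j, max 2 j))\<^sup>2) * c j) = S"
    by (rule S) (auto simp: config_def min_def max_def)
  then show "- z\<^sup>2 * c 0 + s\<^sup>2 * c 1 + S = 0"
    using row[of 2] n unfolding split by (simp add: config_def i2)
  show "(if k = 3 then x\<^sup>2 * c 0 else 0) + c 1 + c 2 + S - c k = 0" if k: "k \<in> {3..n}"
  proof -
    have "(\<Sum>j=3..n. (if k = j then 0 else (config s x z (min k j, max k j))\<^sup>2) * c j) =
        (\<Sum>j\<in>{3..n} - {k}. c j)"
      by (rule sum.mono_neutral_cong_right) (use k in \<open>auto simp: config_def min_def max_def\<close>)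
    also have "\<dots> = S - c k"
      using k by (simp add: S_def sum_diff1)
    finally show ?thesis
      using row[of k] k unfolding split
      by (auto simp: config_def min_def max_def add_diff_eq split: if_splits)
  qed
qed

text \<open>
  Pairing a solution of the system with the kernel vector \<open>(n - 3, n - 3, -2, \<dots>, -2)\<close> of the block
  of the vertices \<open>1, \<dots>, n\<close> eliminates everything but \<open>- 2 * x\<^sup>2 * c 0\<close>. After \<open>c 0 = 0\<close> the other
  unknowns form a multiple of that kernel vector, and row \<open>0\<close> makes the multiple zero.
\<close>

lemma det_config_nonzero:
  assumes n: "n \<ge> 4" and x: "x \<noteq> 0" and s: "of_nat (n - 3) * s\<^sup>2 = of_nat (2 * (n - 2))"
  shows "det (dist_mat n (config s x z)) \<noteq> 0"
proof (rule det_dist_mat_nonzero)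
  fix c :: "nat \<Rightarrow> complex" and j
  assume row: "\<And>i. i \<le> n \<Longrightarrow>
      (\<Sum>j\<le>n. (if i = j then 0 else (config s x z (min i j, max i j))\<^sup>2) * c j) = 0"
    and j: "j \<le> n"
  define S where "S = (\<Sum>j=3..n. c j)"
  note rows = config_rows[OF n row, folded S_def]
  have r0: "z\<^sup>2 * c 1 - z\<^sup>2 * c 2 + x\<^sup>2 * c 3 = 0" and r1: "z\<^sup>2 * c 0 + s\<^sup>2 * c 2 + S = 0"
    and r2: "- z\<^sup>2 * c 0 + s\<^sup>2 * c 1 + S = 0"
    and rk: "\<And>k. k \<in> {3..n} \<Longrightarrow> (if k = 3 then x\<^sup>2 * c 0 else 0) + c 1 + c 2 + S - c k = 0"
    using rows by simp_all
  define m where "m = n - 3"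
  have m: "n = m + 3" using n by (simp add: m_def)
  have S_sum: "(\<Sum>k=3..m + 3. c k) = S" by (simp add: S_def m)
  have sm: "of_nat m * s\<^sup>2 = 2 * of_nat (m + 1)"
    using s by (simp add: m)
  have s0: "s \<noteq> 0"
  proof
    assume "s = 0"
    with sm have "of_nat (m + 1) = (0 :: complex)" by (simp del: of_nat_add of_nat_Suc)
    then show False unfolding of_nat_eq_0_iff by simp
  qed
  have "(\<Sum>k=3..n. (if k = 3 then x\<^sup>2 * c 0 else 0) + c 1 + c 2 + S - c k) = 0"
    using rk by (intro sum.neutral) auto
  then have sum_rest: "x\<^sup>2 * c 0 + of_nat (m + 1) * (c 1 + c 2) + of_nat m * S = 0"
    using m by (simp add: sum.distrib sum_subtractf S_sum algebra_simps)
  (* The rows 3, ..., n have been summed; rows 1 and 2 enter with the factor n - 3 = m. *)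
  have sum_12: "of_nat m * s\<^sup>2 * (c 1 + c 2) + 2 * of_nat m * S = 0"
  proof -
    have "of_nat m * s\<^sup>2 * (c 1 + c 2) + 2 * of_nat m * S =
        of_nat m * ((z\<^sup>2 * c 0 + s\<^sup>2 * c 2 + S) + (- z\<^sup>2 * c 0 + s\<^sup>2 * c 1 + S))"
      by (simp add: algebra_simps)
    then show ?thesis by (simp only: r1 r2 add_0 mult_zero_right)
  qed
  have "2 * (x\<^sup>2 * c 0) =
      2 * (x\<^sup>2 * c 0 + of_nat (m + 1) * (c 1 + c 2) + of_nat m * S) -
      (2 * of_nat (m + 1) * (c 1 + c 2) + 2 * of_nat m * S)"
    by (simp add: algebra_simps)
  also have "\<dots> = 0"
    by (simp only: sum_rest sum_12[unfolded sm]) simp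
  finally have c0: "c 0 = 0" using x by simp
  have "s\<^sup>2 * c 1 = s\<^sup>2 * c 2"
    using r1 r2 c0 by (simp add: add_eq_0_iff)
  then have c12: "c 1 = c 2" using s0 by simp
  then have c3: "c 3 = 0" using r0 x by simp
  then have S0: "2 * c 1 + S = 0" using rk[of 3] n c0 c12 by simp
  have ck: "c k = 0" if "k \<in> {3..n}" for k
    using rk[OF that] S0 c0 c12 by (auto split: if_splits)
  then have "S = 0" unfolding S_def by (intro sum.neutral) auto
  then have "c 1 = 0" "c 2 = 0" using S0 c12 by auto
  moreover have "j = 0 \<or> j = 1 \<or> j = 2 \<or> j \<in> {3..n}"
    using j by auto
  ultimately show "c j = 0" using c0 ck by blast
qed

lemma det_config_0_nonzero:
  assumes n: "n \<ge> 4"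
  shows "det (dist_mat n (config 0 0 1)) \<noteq> 0"
proof (rule det_dist_mat_nonzero)
  fix c :: "nat \<Rightarrow> complex" and j
  assume row: "\<And>i. i \<le> n \<Longrightarrow>
      (\<Sum>j\<le>n. (if i = j then 0 else (config 0 0 1 (min i j, max i j))\<^sup>2) * c j) = 0"
    and j: "j \<le> n"
  define S where "S = (\<Sum>j=3..n. c j)"
  note rows = config_rows[OF n row, folded S_def]
  have c12: "c 1 = c 2" and r: "c 0 + S = 0" "- c 0 + S = 0"
    and rk: "\<And>k. k \<in> {3..n} \<Longrightarrow> (if k = 3 then 0\<^sup>2 * c 0 else 0) + c 1 + c 2 + S - c k = 0"
    using rows by simp_all
  have "2 * S = (c 0 + S) + (- c 0 + S)" by simp
  also have "\<dots> = 0" by (simp only: r add_0)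
  finally have S: "S = 0" by simp
  with r have c0: "c 0 = 0" by simp
  have ck: "c k = 2 * c 1" if "k \<in> {3..n}" for k
    using rk[OF that] S c12 by (auto split: if_splits)
  have "S = (\<Sum>k=3..n. 2 * c 1)" unfolding S_def by (intro sum.cong) (use ck in auto)
  also have "\<dots> = of_nat (card {3..n}) * (2 * c 1)" by (rule sum_constant)
  finally have "of_nat (card {3..n}) * (2 * c 1) = 0" by (simp only: S)
  moreover have "of_nat (card {3..n}) \<noteq> (0 :: complex)"
    unfolding of_nat_eq_0_iff using n by simp
  ultimately have "c 1 = 0" by (metis mult_eq_0_iff zero_neq_numeral)
  moreover have "j = 0 \<or> j = 1 \<or> j = 2 \<or> j \<in> {3..n}"
    using j by auto
  ultimately show "c j = 0" using c0 c12 ck by auto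
qed

text \<open>
  The weight \<open>s\<close> occurs in two entries of the matrix, so a term \<open>s ^ 4\<close> is conceivable. Row \<open>0\<close>
  has only the entries \<open>1\<close> and \<open>- 1\<close>, in the columns \<open>1\<close> and \<open>2\<close>. Adding row \<open>2\<close> and \<open>s\<^sup>2\<close> times
  row \<open>0\<close> to row \<open>1\<close>, and likewise for columns, leaves \<open>s\<close> only in the diagonal entry \<open>2 * s\<^sup>2\<close>
  at \<open>(1, 1)\<close>. Expansion along row \<open>1\<close> then gives the result.
\<close>

lemma det_config_affine:
  assumes n: "n \<ge> 4"
  shows "\<exists>A B. \<forall>s. det (dist_mat n (config s 0 1)) = A + B * s\<^sup>2"
proof -
  define T where "T s = mat (n + 1) (n + 1) (\<lambda>(i, j).
      if i = 1 \<and> j = 1 then 2 * s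
      else if i = 1 then of_bool (j \<ge> 3) * 2
      else if j = 1 then of_bool (i \<ge> 3) * 2
      else dist_mat n (config 0 0 1) $$ (i, j))" for s :: complex
  have T_carrier: "T s \<in> carrier_mat (n + 1) (n + 1)" for s
    by (simp add: T_def)
  have "det (dist_mat n (config s 0 1)) = det (T (s\<^sup>2))" for s
  proof -
    let ?M = "dist_mat n (config s 0 1)"
    have M: "?M \<in> carrier_mat (n + 1) (n + 1)" by (rule dist_mat_carrier)
    define R where "R = addrow (s\<^sup>2) 1 0 (addrow 1 1 2 ?M)"
    have R: "R \<in> carrier_mat (n + 1) (n + 1)" and detR: "det R = det ?M"
      using n M by (simp_all add: R_def det_addrow[of _ "n + 1"])
    have "addcol (s\<^sup>2) 1 0 (addcol 1 1 2 R) = T (s\<^sup>2)"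
    proof (rule eq_matI)
      fix i j assume "i < dim_row (T (s\<^sup>2))" "j < dim_col (T (s\<^sup>2))"
      then have ij: "i < n + 1" "j < n + 1" by (simp_all add: T_def)
      have Mij: "?M $$ (a, b) = (if a = b then 0 else (config s 0 1 (min a b, max a b))\<^sup>2)"
        if "a < n + 1" "b < n + 1" for a b using that by (simp add: dist_mat_def)
      have Rij: "R $$ (a, b) = (if a = 1 then s\<^sup>2 * ?M $$ (0, b) + (?M $$ (2, b) + ?M $$ (1, b)) else ?M $$ (a, b))"
        if "a < n + 1" "b < n + 1" for a b
        using that n M by (simp add: R_def)
      have R1: "R $$ (1, b) = (if b = 1 then 2 * s\<^sup>2 else of_bool (b \<ge> 3) * 2)" if "b < n + 1" for b
        using that n by (auto simp: Rij Mij config_def)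
      have "addcol (s\<^sup>2) 1 0 (addcol 1 1 2 R) $$ (i, j) =
          (if j = 1 then s\<^sup>2 * R $$ (i, 0) + (R $$ (i, 2) + R $$ (i, 1)) else R $$ (i, j))"
        using ij n R by simp
      also have "\<dots> = T (s\<^sup>2) $$ (i, j)"
      proof (cases "i = 1")
        case True
        then show ?thesis using ij n R1[of 0] R1[of 1] R1[of 2] R1[of j] by (simp add: T_def)
      next
        case False
        then have "\<And>b. b < n + 1 \<Longrightarrow> R $$ (i, b) = ?M $$ (i, b)" using ij by (simp add: Rij)
        then show ?thesis using ij n False
          by (auto simp: T_def dist_mat_def config_def min_def max_def)
      qed
      finally show "addcol (s\<^sup>2) 1 0 (addcol 1 1 2 R) $$ (i, j) = T (s\<^sup>2) $$ (i, j)" .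
    qed (use R in \<open>simp_all add: T_def\<close>)
    moreover have "det (addcol (s\<^sup>2) 1 0 (addcol 1 1 2 R)) = det R"
      by (rule trans[OF det_addcol[of _ "n + 1"] det_addcol[of _ "n + 1"]]) (use n R in auto)
    ultimately show ?thesis using detR by simp
  qed
  moreover have "det (T s) = (\<Sum>j\<in>{..<n + 1} - {1}. of_bool (j \<ge> 3) * 2 * cofactor (T 0) 1 j) +
      2 * cofactor (T 0) 1 1 * s" for s
  proof -
    (* The cofactors of row 1 do not see the only entry that depends on s. *)
    have cof: "cofactor (T s) 1 j = cofactor (T 0) 1 j" for j
    proof -
      have "mat_delete (T s) 1 j = mat_delete (T 0) 1 j"
        by (rule eq_matI) (auto simp: mat_delete_def T_def)
      then show ?thesis by (simp add: cofactor_def)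
    qed
    have "det (T s) = (\<Sum>j<n + 1. T s $$ (1, j) * cofactor (T s) 1 j)"
      by (rule laplace_expansion_row[OF T_carrier]) (use n in simp)
    also have "\<dots> = (\<Sum>j<n + 1. T s $$ (1, j) * cofactor (T 0) 1 j)"
      by (simp only: cof)
    also have "\<dots> = T s $$ (1, 1) * cofactor (T 0) 1 1 +
        (\<Sum>j\<in>{..<n + 1} - {1}. T s $$ (1, j) * cofactor (T 0) 1 j)"
      using n by (intro sum.remove) auto
    also have "(\<Sum>j\<in>{..<n + 1} - {1}. T s $$ (1, j) * cofactor (T 0) 1 j) =
        (\<Sum>j\<in>{..<n + 1} - {1}. of_bool (j \<ge> 3) * 2 * cofactor (T 0) 1 j)"
      using n by (intro sum.cong refl) (auto simp: T_def)
    also have "T s $$ (1, 1) = 2 * s"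
      using n by (simp add: T_def)
    finally show ?thesis by simp
  qed
  ultimately show ?thesis by (intro exI allI) (simp only:)
qed

section \<open>Irreducibility\<close>

lemma affine_line:
  "\<exists>q. \<forall>t. poly q t = value_at (\<lambda>e. a e + t * b e) p"
  by (rule exI[of _ "along (\<lambda>e. [:a e, b e:]) p"]) (simp add: poly_along)

text \<open>
  Each weight of \<open>config\<close> is affine in each parameter, so a polynomial restricted to a line in the
  parameter space is a univariate polynomial.
\<close>

lemma config_line:
  obtains q where "\<And>t. poly q t = value_at (config (s0 + t * s1) (x0 + t * x1) (z0 + t * z1)) p"
proof -
  have *: "config (s0 + t * s1) (x0 + t * x1) (z0 + t * z1) =
      (\<lambda>e. config s0 x0 z0 e + t * (config (s0 + s1) (x0 + x1) (z0 + z1) e - config s0 x0 z0 e))" for t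
    by (rule ext) (simp add: config_def algebra_simps)
  obtain q where "\<And>t. poly q t = value_at (\<lambda>e. config s0 x0 z0 e +
      t * (config (s0 + s1) (x0 + x1) (z0 + z1) e - config s0 x0 z0 e)) p"
    using affine_line[of "config s0 x0 z0"
        "\<lambda>e. config (s0 + s1) (x0 + x1) (z0 + z1) e - config s0 x0 z0 e" p] by blast
  then have "poly q t = value_at (config (s0 + t * s1) (x0 + t * x1) (z0 + t * z1)) p" for t
    unfolding * .
  then show ?thesis by (rule that)
qed

lemma zero_free_poly_constant:
  fixes q :: "complex poly"
  assumes "\<And>t. poly q t \<noteq> 0"
  shows "poly q a = poly q b"
  using fundamental_theorem_of_algebra[of q] assms by (auto simp: constant_def)

text \<open>
  If vertex \<open>0\<close> is isolated, scaling its edges by \<open>0\<close> changes nothing, yet it multiplies the value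
  by \<open>0 ^ k\<close>.
\<close>

lemma factor_vanishes_at_isolated_vertex:
  assumes homog: "\<And>m. m \<in> Poly_Mapping.keys p \<Longrightarrow> weight (incidence 0) m = k" and "k > 0"
  shows "value_at (config s 0 0) p = (0 :: complex)"
proof -
  have "(\<lambda>e. 0 ^ incidence 0 e * config s 0 0 e) = config s 0 0"
    by (rule ext) (auto simp: incidence_def config_def)
  then show ?thesis
    using value_at_scaled[OF homog, of p 0 "config s 0 0"] \<open>k > 0\<close>
    by (simp add: power_0_left)
qed

text \<open>
  For \<open>x \<noteq> 0\<close> the product \<open>p * q\<close> has no zero on the line where \<open>z\<close> varies, so \<open>p\<close> is constant on it
  by the fundamental theorem of algebra. The values at \<open>z = 1\<close> and \<open>z = 0\<close> are polynomials in
  \<open>x\<close> that agree for all \<open>x \<noteq> 0\<close>, hence also at \<open>x = 0\<close>.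
\<close>

lemma factor_vanishes_on_config:
  fixes p q :: "(nat \<times> nat, complex) mpoly"
  assumes n: "n \<ge> 4" and pq: "Delta n = p * q"
    and homog: "\<And>m. m \<in> Poly_Mapping.keys p \<Longrightarrow> weight (incidence 0) m = k" and "k > 0"
    and s: "of_nat (n - 3) * s\<^sup>2 = of_nat (2 * (n - 2))"
  shows "value_at (config s 0 1) p = 0"
proof -
  have indep: "value_at (config s x 1) p = value_at (config s x 0) p" if x: "x \<noteq> 0" for x
  proof -
    obtain f where f: "\<And>t. poly f t = value_at (config (s + t * 0) (x + t * 0) (0 + t * 1)) p"
      using config_line by blast
    have "value_at (config s x t) p * value_at (config s x t) q \<noteq> 0" for t
      using det_config_nonzero[OF n x s] by (simp add: pq flip: value_at_Delta value_at.hom_mult)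
    then have "poly f t \<noteq> 0" for t by (simp add: f)
    from zero_free_poly_constant[OF this, of 1 0] show ?thesis by (simp add: f)
  qed
  obtain f where f: "\<And>t. poly f t = value_at (config (s + t * 0) (0 + t * 1) (1 + t * 0)) p"
    using config_line by blast
  obtain g where g: "\<And>t. poly g t = value_at (config (s + t * 0) (0 + t * 1) (0 + t * 0)) p"
    using config_line by blast
  have "f = g"
  proof (rule ccontr)
    assume "f \<noteq> g"
    then have "finite {t. poly (f - g) t = 0}" by (intro poly_roots_finite) simp
    moreover have "UNIV - {0} \<subseteq> {t. poly (f - g) t = 0}"
      using indep by (auto simp: f g)
    ultimately have "finite (UNIV - {0 :: complex})" by (rule finite_subset[rotated])
    then show False by (simp add: infinite_UNIV_char_0)
  qed
  then have "value_at (config s 0 1) p = value_at (config s 0 0) p"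
    using f[of 0] g[of 0] by simp
  also have "\<dots> = 0" by (rule factor_vanishes_at_isolated_vertex[OF homog \<open>k > 0\<close>])
  finally show ?thesis .
qed

text \<open>
  Both factors vanish at \<open>t = s\<close>, so the derivative of \<open>A + B * t\<^sup>2\<close> vanishes there too; as
  \<open>s \<noteq> 0\<close>, this forces \<open>B = 0\<close> and then \<open>A = 0\<close>.
\<close>

lemma no_factors_of_positive_vertex_degree:
  fixes p q :: "(nat \<times> nat, complex) mpoly"
  assumes n: "n \<ge> 4" and pq: "Delta n = p * q"
    and p: "\<And>m. m \<in> Poly_Mapping.keys p \<Longrightarrow> weight (incidence 0) m = k" "k > 0"
    and q: "\<And>m. m \<in> Poly_Mapping.keys q \<Longrightarrow> weight (incidence 0) m = l" "l > 0"
  shows False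
proof -
  define s :: complex where "s = csqrt (of_nat (2 * (n - 2)) / of_nat (n - 3))"
  have n3: "of_nat (n - 3) \<noteq> (0 :: complex)" and n2: "of_nat (2 * (n - 2)) \<noteq> (0 :: complex)"
    unfolding of_nat_eq_0_iff using n by auto
  have s: "of_nat (n - 3) * s\<^sup>2 = of_nat (2 * (n - 2))"
    unfolding s_def power2_csqrt
    using n3 by (metis nonzero_mult_div_cancel_left times_divide_eq_right)
  have s0: "s \<noteq> 0" using s n2 by (metis mult_zero_right zero_power2)
  obtain A B where AB: "\<And>t. det (dist_mat n (config t 0 1)) = A + B * t\<^sup>2"
    using det_config_affine[OF n] by blast
  obtain f where f: "\<And>t. poly f t = value_at (config (0 + t * 1) (0 + t * 0) (1 + t * 0)) p"
    using config_line by blast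
  obtain g where g: "\<And>t. poly g t = value_at (config (0 + t * 1) (0 + t * 0) (1 + t * 0)) q"
    using config_line by blast
  have fs: "poly f s = 0"
    using factor_vanishes_on_config[OF n pq p s] by (simp add: f)
  have qp: "Delta n = q * p" using pq by (simp add: mult.commute)
  have gs: "poly g s = 0"
    using factor_vanishes_on_config[OF n qp q s] by (simp add: g)
  have "poly (f * g) t = poly [:A, 0, B:] t" for t
    using AB[of t] by (simp add: f g pq power2_eq_square algebra_simps flip: value_at_Delta value_at.hom_mult)
  then have fg: "f * g = [:A, 0, B:]"
    by (intro poly_eq_poly_eq_iff[THEN iffD1] ext)
  then have "poly (pderiv [:A, 0, B:]) s = poly (pderiv (f * g)) s" by simp
  also have "\<dots> = 0" by (simp add: pderiv_mult fs gs)
  finally have "B = 0" using s0 by (simp add: pderiv_pCons)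
  moreover have "poly [:A, 0, B:] s = 0" by (simp add: fs flip: fg)
  ultimately have "A = 0" by simp
  with \<open>B = 0\<close> AB[of 0] det_config_0_nonzero[OF n] show False by simp
qed

text \<open>
  The degree \<open>a i\<close> of a factor at vertex \<open>i\<close> exists because a factor of a homogeneous polynomial is
  homogeneous. It is compared with \<open>a 0\<close> on \<open>edge_plus_clique i 0\<close>, where doubling the edges at \<open>i\<close>
  and doubling those at \<open>0\<close> give the same point, at which the factor is nonzero.
\<close>

lemma factor_vertex_degrees:
  fixes p q :: "(nat \<times> nat, complex) mpoly"
  assumes n: "n \<ge> 3" and pq: "Delta n = p * q"
  obtains k where "\<And>i m. i \<le> n \<Longrightarrow> m \<in> Poly_Mapping.keys p \<Longrightarrow> weight (incidence i) m = k"
proof -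
  have nz: "value_at (edge_plus_clique i j) p \<noteq> 0" if "i \<le> n" "j \<le> n" "i \<noteq> j" for i j
    using det_edge_plus_clique[OF n that] pq value_at_Delta[of "edge_plus_clique i j" n]
    by (auto simp: value_at.hom_mult)
  have "p * q \<noteq> 0"
    using det_edge_plus_clique[OF n, of 0 1] n by (auto simp flip: pq value_at_Delta)
  have "\<exists>k. \<forall>m \<in> Poly_Mapping.keys p. weight (incidence i) m = k" if "i \<le> n" for i
    using factor_of_homogeneous[OF grading_Delta[OF that, where ?'a = complex, unfolded pq] \<open>p * q \<noteq> 0\<close>]
    by metis
  then obtain a where a: "\<And>i m. i \<le> n \<Longrightarrow> m \<in> Poly_Mapping.keys p \<Longrightarrow> weight (incidence i) m = a i"
    by metis
  have "a i = a 0" if i: "i \<le> n" for i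
  proof (cases "i = 0")
    case False
    have "(\<lambda>e. 2 ^ incidence i e * edge_plus_clique i 0 e) =
        (\<lambda>e. 2 ^ incidence 0 e * edge_plus_clique i 0 e)"
      using False by (auto simp: incidence_def edge_plus_clique_def doubleton_eq_iff)
    then have "2 ^ a i * value_at (edge_plus_clique i 0) p =
        2 ^ a 0 * value_at (edge_plus_clique i 0) p"
      using value_at_scaled[of p "incidence i" "a i" 2 "edge_plus_clique i 0"]
        value_at_scaled[of p "incidence 0" "a 0" 2 "edge_plus_clique i 0"] a i by auto
    then have "(2 :: complex) ^ a i = 2 ^ a 0" using nz[OF i _ False] by simp
    then have "of_nat (2 ^ a i) = (of_nat (2 ^ a 0) :: complex)" by simp
    then show ?thesis unfolding of_nat_eq_iff by simp
  qed simp
  then show ?thesis using that[of "a 0"] a by metis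
qed

text \<open>A variable occurring in \<open>p\<close> would contribute to the degree at either of its end points.\<close>

lemma mpoly_ring_Units:
  assumes p: "p \<in> carrier (mpoly_ring (dist_vars n))" "p \<noteq> 0"
    and deg: "\<And>i m. i \<le> n \<Longrightarrow> m \<in> Poly_Mapping.keys p \<Longrightarrow> weight (incidence i) m = 0"
  shows "p \<in> Units (mpoly_ring (dist_vars n) :: (nat \<times> nat, 'a::field) mpoly ring)"
proof -
  have "m = 0" if m: "m \<in> Poly_Mapping.keys p" for m
  proof (rule ccontr)
    assume "m \<noteq> 0"
    then obtain e where e: "e \<in> Poly_Mapping.keys m"
      by (metis all_not_in_conv keys_eq_empty)
    then have "e \<in> dist_vars n" using p(1) m by (auto simp: mpoly_ring_carrier_iff)
    then have "fst e \<le> n" by (auto simp: dist_vars_def)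
    from deg[OF this m] e have "incidence (fst e) e * Poly_Mapping.lookup m e = 0"
      by (simp add: weight_def)
    with e show False by (simp add: incidence_def in_keys_iff)
  qed
  then have ps: "p = Poly_Mapping.single 0 (Poly_Mapping.lookup p 0)"
    by (intro poly_mapping_eqI) (auto simp: lookup_single when_def in_keys_iff)
  let ?q = "Poly_Mapping.single 0 (inverse (Poly_Mapping.lookup p 0)) :: (nat \<times> nat, 'a) mpoly"
  have "Poly_Mapping.lookup p 0 \<noteq> 0" using ps p(2) by (metis single_zero)
  then have "p * ?q = 1" by (subst ps) (simp add: mult_single)
  moreover have "?q \<in> carrier (mpoly_ring (dist_vars n))"
    by (simp add: mpoly_ring_carrier_iff)
  ultimately show ?thesis using p(1) by (auto simp: Units_def mult.commute)
qed

lemma domain_mpoly_ring: "domain (mpoly_ring V :: ('v::linorder, 'a::idom) mpoly ring)"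
proof -
  interpret cring "mpoly_ring V :: ('v, 'a) mpoly ring" by (rule cring_mpoly_ring)
  show ?thesis by unfold_locales auto
qed

theorem theorem1p2:
  fixes n :: nat
  assumes "n \<ge> 4"
  shows "ring_irreducible\<^bsub>mpoly_ring (dist_vars n)\<^esub>
           (Delta n :: (nat \<times> nat, complex) mpoly)"
proof (rule domain.ring_irreducibleI[OF domain_mpoly_ring])
  let ?R = "mpoly_ring (dist_vars n) :: (nat \<times> nat, complex) mpoly ring"
  let ?D = "Delta n :: (nat \<times> nat, complex) mpoly"
  have nz: "?D \<noteq> 0"
    using det_config_0_nonzero[OF assms] by (auto simp flip: value_at_Delta)
  then show "?D \<in> carrier ?R - {\<zero>\<^bsub>?R\<^esub>}"
    by (simp add: Delta_carrier)
  have "value_at (\<lambda>_. 0) ?D = 0"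
    unfolding value_at_Delta
    by (subst laplace_expansion_row[OF dist_mat_carrier, of 0])
      (simp, rule sum.neutral, auto simp: dist_mat_def)
  then have "?D * q \<noteq> 1" for q
    by (metis mult_zero_left value_at.hom_mult value_at.hom_one zero_neq_one)
  then show "?D \<notin> Units ?R" by (auto simp: Units_def)
  fix p q assume p: "p \<in> carrier ?R" and q: "q \<in> carrier ?R" and "?D = p \<otimes>\<^bsub>?R\<^esub> q"
  then have pq: "?D = p * q" by simp
  have n3: "n \<ge> 3" using assms by simp
  obtain k where k: "\<And>i m. i \<le> n \<Longrightarrow> m \<in> Poly_Mapping.keys p \<Longrightarrow> weight (incidence i) m = k"
    using factor_vertex_degrees[OF n3 pq] by metis
  obtain l where l: "\<And>i m. i \<le> n \<Longrightarrow> m \<in> Poly_Mapping.keys q \<Longrightarrow> weight (incidence i) m = l"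
    using factor_vertex_degrees[OF n3, of q p] pq by (metis mult.commute)
  have "k = 0 \<or> l = 0"
    using no_factors_of_positive_vertex_degree[OF assms pq, of k l] k l by auto
  then show "p \<in> Units ?R \<or> q \<in> Units ?R"
    using mpoly_ring_Units[OF p] mpoly_ring_Units[OF q] k l nz pq by auto
qed

end
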